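(* Consider stores $\ell\in\{1,\ldots,L\}$, each described by its own single-store driver-allocation POMDP as in the context, under the standing assumptions given there. For every store $\ell$, every period $t\in\{1,\ldots,T\}$, every belief $\mathbf{b}\in\Delta^{K-1}$ and every driver rank $j\ge 1$, the priority index $\Lambda_\ell^{(j)}(s,\mathbf{b})$ at period $t$ is non-decreasing in the backlog $s\in\mathbb{Z}_{\ge 0}$. Moreover, $\Lambda_\ell^{(j+1)}(s+v,\mathbf{b})\le\Lambda_\ell^{(j)}(s,\mathbf{b})$ for every $s\in\mathbb{Z}_{\ge 0}$ and every rank $j\ge 1$.
   Context: **Single-store model** (one for each store $\ell$; the transition matrix $\mathbf{T}$ and emission distributions $f_k$ may depend on $\ell$, and the subscript $\ell$ is dropped here). **Parameters.** $T\ge 1$ (number of periods), $K\ge 1$ (number of demand regimes), $v\in\mathbb{Z}_{>0}$ (orders per driver per period), $x_{\max}\in\mathbb{Z}_{\ge 0}$, $a_{\min}\in\mathbb{Z}_{\ge 0}$; real numbers $p,c_a,c_p,c_b,c_{\mathrm{lost}}>0$. Put $q:=p-c_p$. $\Delta^{K-1}$ is the set of probability vectors on $\{1,\ldots,K\}$. **Standing assumptions.** $vp-vc_p-c_a>0$; $q>0$ (A1); $c_b>q$ (A2); $c_{\mathrm{lost}}>c_b$; the regime transition matrix does not depend on the action (A3); the upper bound on the action is non-binding (A4), so actions are taken in $\mathcal{A}=\{a\in\mathbb{Z}: a\ge a_{\min}\}$. **Demand and beliefs.** Fix a day of week $d$. For each period $t$ (at hour $h_t$) and regime $k$, $f_k(\cdot;d,h_t)$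 is a probability mass function on $\{0,1,\ldots,x_{\max}\}$. $\mathbf{T}$ is a $K\times K$ row-stochastic matrix. Given belief $\mathbf{b}$ at period $t$ and observed demand $x$, the next belief is $\mathbf{b}_{t+1}(x)=\mathbf{T}^\top\mathbf{b}^+$, where $b^+(j)=b(j)f_j(x;d,h_t)/\sum_{k}b(k)f_k(x;d,h_t)$ (defined arbitrarily in $\Delta^{K-1}$ when the denominator is $0$; such $x$ have weight zero below). **Reward and backlog.** With backlog $s\in\mathbb{Z}_{\ge 0}$, demand $x$ and action $a$, $$r(x,s,a)=p\min\{x+s,va\}-c_a a-c_p\min\{x+s,va\}-c_b s,$$ and the next backlog is $\max\{x+s-va,0\}$. For a shadow price $\lambda\ge 0$ put $r^\lambda(x,s,a)=r(x,s,a)-\lambda a$. **Value functions at price $\lambda$.** $V_{T+1}(s,\mathbf{b};\lambda)=-c_{\mathrm{lost}}\,s$, and for $t=T,\ldots,1$, $$Q_t(s,\mathbf{b},a;\lambda)=\sum_{k=1}^K b(k)\sum_{x=0}^{x_{\max}}\Bigl[r^\lambda(x,s,a)+V_{t+1}\bigl(\max\{x+s-va,0\},\mathbf{b}_{t+1}(x);\lambda\bigr)\Bigr]f_k(x;d,h_t),$$ $V_t(s,\mathbf{b};\lambda)=\max_{a\in\mathcal{A}}Q_t(s,\mathbf{b},a;\lambda)$. The maximum is attained, since once $va\ge x_{\max}+s$ increasing $a$ only adds cost. The optimal driver count is the smallest maximizer $a^*_t(s,\mathbf{b};\lambda):=\min\bigl(\arg\max_{a\in\mathcal{A}}Q_t(s,\mathbf{b},a;\lambda)\bigr)$.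 **Priority index.** At period $t$ and state $(s,\mathbf{b})$, the $j$-th driver priority index of the store is $$\Lambda^{(j)}(s,\mathbf{b})=\inf\{\lambda\ge 0:\ a^*_t(s,\mathbf{b};\lambda)<j\}\in[0,+\infty],\qquad j=1,2,\ldots,$$ with $\inf\emptyset=+\infty$ (for store $\ell$ it is written $\Lambda_\ell^{(j)}$). *)

theory Defs
  imports "HOL-Probability.Probability"
begin

text \<open>
  The demand regimes are the elements of a finite type \<open>'k\<close>, so that \<open>K = CARD('k) \<ge> 1\<close>.
  Days of the week and hours only serve as labels of the emission distributions and are left as
  arbitrary types \<open>'d\<close> and \<open>'h\<close>.  Backlogs, demands and actions are natural numbers; the action
  set is \<open>{a. a_min \<le> a}\<close> with \<open>a_min \<ge> 0\<close>, without an upper bound.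
\<close>

record ('d, 'h) params =
  horizon :: nat
  capacity :: nat  \<comment> \<open>\<open>v\<close>, orders per driver per period\<close>
  x_max :: nat
  a_min :: nat
  price :: real
  c_a :: real
  c_p :: real
  c_b :: real
  c_lost :: real
  day :: 'd
  hour :: "nat \<Rightarrow> 'h"

text \<open>
  \<open>default_belief t b x\<close> is the arbitrary next belief used when the demand \<open>x\<close> has probability
  zero under the belief \<open>b\<close> at period \<open>t\<close>.
\<close>

record ('k, 'd, 'h) store =
  trans_mat :: "real ^ 'k ^ 'k"
  emission :: "'k \<Rightarrow> 'd \<Rightarrow> 'h \<Rightarrow> nat pmf"
  default_belief :: "nat \<Rightarrow> real ^ 'k \<Rightarrow> nat \<Rightarrow> real ^ 'k"

definition beliefs :: "(real ^ 'k) set" where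
  "beliefs = {b. (\<forall>k. 0 \<le> b $ k) \<and> (\<Sum>k\<in>UNIV. b $ k) = 1}"

definition valid_params :: "('d, 'h) params \<Rightarrow> bool" where
  "valid_params M \<longleftrightarrow>
     1 \<le> horizon M \<and> 1 \<le> capacity M \<and>
     0 < price M \<and> 0 < c_a M \<and> 0 < c_p M \<and> 0 < c_b M \<and> 0 < c_lost M \<and>
     real (capacity M) * price M - real (capacity M) * c_p M - c_a M > 0 \<and>
     price M - c_p M > 0 \<and>
     c_b M > price M - c_p M \<and>
     c_lost M > c_b M"

definition valid_store :: "('d, 'h) params \<Rightarrow> ('k::finite, 'd, 'h) store \<Rightarrow> bool" where
  "valid_store M S \<longleftrightarrow>
     (\<forall>i. row i (trans_mat S) \<in> beliefs) \<and>
     (\<forall>k. \<forall>t\<in>{1..horizon M}. set_pmf (emission S k (day M) (hour M t)) \<subseteq> {0..x_max M}) \<and>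
     (\<forall>t\<in>{1..horizon M}. \<forall>b\<in>beliefs. \<forall>x\<in>{0..x_max M}. default_belief S t b x \<in> beliefs)"

definition emission_prob ::
  "('d, 'h) params \<Rightarrow> ('k::finite, 'd, 'h) store \<Rightarrow> nat \<Rightarrow> 'k \<Rightarrow> nat \<Rightarrow> real" where
  "emission_prob M S t k x = pmf (emission S k (day M) (hour M t)) x"

definition next_belief ::
  "('d, 'h) params \<Rightarrow> ('k::finite, 'd, 'h) store \<Rightarrow> nat \<Rightarrow> real ^ 'k \<Rightarrow> nat \<Rightarrow> real ^ 'k" where
  "next_belief M S t b x =
     (let den = (\<Sum>k\<in>UNIV. b $ k * emission_prob M S t k x)
      in if den = 0 then default_belief S t b x
         else transpose (trans_mat S) *v (\<chi> j. b $ j * emission_prob M S t j x / den))"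

definition reward :: "('d, 'h) params \<Rightarrow> nat \<Rightarrow> nat \<Rightarrow> nat \<Rightarrow> real" where
  "reward M x s a =
     price M * real (min (x + s) (capacity M * a)) - c_a M * real a
     - c_p M * real (min (x + s) (capacity M * a)) - c_b M * real s"

definition reward_at :: "('d, 'h) params \<Rightarrow> real \<Rightarrow> nat \<Rightarrow> nat \<Rightarrow> nat \<Rightarrow> real" where
  "reward_at M lam x s a = reward M x s a - lam * real a"

text \<open>Truncated subtraction on the naturals is the positive part \<open>max {x + s - v a, 0}\<close>.\<close>

definition next_backlog :: "('d, 'h) params \<Rightarrow> nat \<Rightarrow> nat \<Rightarrow> nat \<Rightarrow> nat" where
  "next_backlog M x s a = x + s - capacity M * a"

definition lookahead ::
  "('d, 'h) params \<Rightarrow> ('k::finite, 'd, 'h) store \<Rightarrow> real \<Rightarrow> nat \<Rightarrow> (nat \<Rightarrow> real ^ 'k \<Rightarrow> real) \<Rightarrow>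
   nat \<Rightarrow> real ^ 'k \<Rightarrow> nat \<Rightarrow> real" where
  "lookahead M S lam t W s b a =
     (\<Sum>k\<in>UNIV. b $ k *
        (\<Sum>x = 0..x_max M.
           (reward_at M lam x s a + W (next_backlog M x s a) (next_belief M S t b x))
           * emission_prob M S t k x))"

text \<open>\<open>GREATEST y. y \<in> A\<close> is the maximum of the (here infinite) set \<open>A\<close>.\<close>

function V ::
  "('d, 'h) params \<Rightarrow> ('k::finite, 'd, 'h) store \<Rightarrow> real \<Rightarrow> nat \<Rightarrow> nat \<Rightarrow> real ^ 'k \<Rightarrow> real" where
  "V M S lam t s b =
     (if horizon M < t then - c_lost M * real s
      else (GREATEST y. y \<in> lookahead M S lam t (\<lambda>s' b'. V M S lam (Suc t) s' b') s b ` {a_min M..}))"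
  by pat_completeness auto
termination
  by (relation "Wellfounded.measure (\<lambda>(M, S, lam, t, s, b). Suc (horizon M) - t)") auto

declare V.simps [simp del]

definition Q ::
  "('d, 'h) params \<Rightarrow> ('k::finite, 'd, 'h) store \<Rightarrow> real \<Rightarrow> nat \<Rightarrow> nat \<Rightarrow> real ^ 'k \<Rightarrow> nat \<Rightarrow> real" where
  "Q M S lam t s b a = lookahead M S lam t (V M S lam (Suc t)) s b a"

definition opt_drivers ::
  "('d, 'h) params \<Rightarrow> ('k::finite, 'd, 'h) store \<Rightarrow> real \<Rightarrow> nat \<Rightarrow> nat \<Rightarrow> real ^ 'k \<Rightarrow> nat" where
  "opt_drivers M S lam t s b = (LEAST a. is_arg_max (Q M S lam t s b) (\<lambda>a. a \<in> {a_min M..}) a)"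

definition priority_index ::
  "('d, 'h) params \<Rightarrow> ('k::finite, 'd, 'h) store \<Rightarrow> nat \<Rightarrow> nat \<Rightarrow> nat \<Rightarrow> real ^ 'k \<Rightarrow> ereal" where
  "priority_index M S t j s b = Inf (ereal ` {lam. 0 \<le> lam \<and> opt_drivers M S lam t s b < j})"

end

theory Submission imports Defs begin

text \<open>
  At a fixed price the claim reduces to \<open>a\<^sup>* (s) \<le> a\<^sup>* (s + 1)\<close> and
  \<open>a\<^sup>* (s + v) \<le> a\<^sup>* (s) + 1\<close> for the smallest maximizer.  The second bound holds because
  \<open>Q (s + v, a + 1)\<close> and \<open>Q (s, a)\<close> differ by a constant.  The first follows from increasing
  differences of \<open>Q\<close> in \<open>(s, a)\<close>.  Since actions move the backlog in steps of \<open>v\<close>, the value function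
  need not be concave in \<open>s\<close>; the property that propagates through the Bellman recursion is that \<open>V\<close> is
  non-increasing and that \<open>V (s + v) - V (s)\<close> is non-increasing in \<open>s\<close>.
\<close>

text \<open>Comparing \<open>s\<close> with its successor gives concavity along each residue class
  modulo \<open>v\<close> and also relates neighbouring classes. Monotonicity of \<open>U\<close> is
  included for the case of an only partly loaded extra driver.\<close>

definition step_concave :: "nat \<Rightarrow> (nat \<Rightarrow> real) \<Rightarrow> bool" where
  "step_concave v U \<longleftrightarrow> antimono U \<and> antimono (\<lambda>s. U (s + v) - U s)"

section \<open>Maxima and least maximizers over an unbounded action set\<close>

definition max_from :: "nat \<Rightarrow> (nat \<Rightarrow> real) \<Rightarrow> real" where
  "max_from m f = (GREATEST y. y \<in> f ` {m..})"

definition least_argmax_from :: "nat \<Rightarrow> (nat \<Rightarrow> real) \<Rightarrow> nat" where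
  "least_argmax_from m f = (LEAST a. is_arg_max f (\<lambda>a. a \<in> {m..}) a)"

text \<open>No value beyond \<open>B\<close> exceeds \<open>f B\<close>, so the maximum over the
  finite window \<open>{m..B}\<close> is global.\<close>

lemma eventually_nonincreasing_attains_max:
  fixes f :: "nat \<Rightarrow> real"
  assumes "\<And>a. A \<le> a \<Longrightarrow> f (Suc a) \<le> f a"
  shows "\<exists>a\<ge>m. \<forall>a'\<ge>m. f a' \<le> f a"
proof -
  define B where "B = max A m"
  have tail: "f a \<le> f B" if "B \<le> a" for a
    using that
  proof (induction a rule: dec_induct)
    case (step n)
    then show ?case using assms[of n] by (simp add: B_def)
  qed simp
  have fin: "finite (f ` {m..B})" "f ` {m..B} \<noteq> {}"
    by (auto simp: B_def)
  obtain a where a: "a \<in> {m..B}" "f a = Max (f ` {m..B})"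
    using Max_in[OF fin] by force
  have "f a' \<le> f a" if "m \<le> a'" for a'
  proof (cases "a' \<le> B")
    case True
    then show ?thesis using a that fin by auto
  next
    case False
    have "f B \<le> f a" using a fin by (auto simp: B_def)
    then show ?thesis using tail[of a'] False by linarith
  qed
  then show ?thesis using a by auto
qed

section \<open>The one-period problem for fixed price, period and belief\<close>

locale driver_problem =
  fixes F :: "nat \<Rightarrow> nat \<Rightarrow> real" and m v :: nat and \<kappa> :: real
  assumes increasing_differences:
      "F s (Suc a) - F s a \<le> F (Suc s) (Suc a) - F (Suc s) a"
    and shift: "F (s + v) (Suc a) = F s a + \<kappa>"
    and antimono_backlog: "F (Suc s) a \<le> F s a"
    and attains_max: "\<exists>a\<ge>m. \<forall>a'\<ge>m. F s a' \<le> F s a"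
begin

lemma increasing_differences_le:
  assumes "a \<le> a'" "s \<le> s'"
  shows "F s a' - F s a \<le> F s' a' - F s' a"
proof -
  have step: "F s (Suc a) - F s a \<le> F s' (Suc a) - F s' a" for a
    using lift_Suc_mono_le[of "\<lambda>s. F s (Suc a) - F s a"] increasing_differences assms(2) by blast
  show ?thesis
    using assms(1)
  proof (induction a' rule: dec_induct)
    case (step n)
    then show ?case using \<open>F s (Suc n) - F s n \<le> F s' (Suc n) - F s' n\<close> by linarith
  qed simp
qed

lemma max_from_eqI:
  assumes "m \<le> a" "\<And>a'. m \<le> a' \<Longrightarrow> F s a' \<le> F s a"
  shows "max_from m (F s) = F s a"
  unfolding max_from_def by (rule Greatest_equality) (use assms in auto)

lemma max_from_attained:
  obtains a where "m \<le> a" "max_from m (F s) = F s a"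
  using attains_max[of s] max_from_eqI by metis

lemma max_from_ge:
  assumes "m \<le> a"
  shows "F s a \<le> max_from m (F s)"
  using attains_max[of s] max_from_eqI assms by metis

text \<open>This is the step of the Bellman induction. The \<open>v\<close>-step increment of the
  maximum is always at least \<open>\<kappa>\<close>. At \<open>Suc s\<close> it is at most
  \<open>\<kappa>\<close> if a maximizer at \<open>Suc s + v\<close> can give up a driver; otherwise
  that maximizer is \<open>m\<close>, and then \<open>m\<close> is optimal at \<open>s\<close>
  too.\<close>

lemma step_concave_max_from: "step_concave v (\<lambda>s. max_from m (F s))"
proof -
  let ?V = "\<lambda>s. max_from m (F s)"
  have "?V (Suc s) \<le> ?V s" for s
    using max_from_attained[of "Suc s"] max_from_ge antimono_backlog order_trans by metis
  moreover have "?V (Suc s + v) - ?V (Suc s) \<le> ?V (s + v) - ?V s" for s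
  proof -
    \<comment> \<open>Adding one driver to a maximizer at \<open>s\<close> gives a feasible action
      at \<open>s + v\<close>.\<close>
    have lower: "?V s + \<kappa> \<le> ?V (s + v)" for s
      using max_from_attained[of s] max_from_ge[of _ "s + v"] shift by (metis le_Suc_eq)
    obtain a where a: "m \<le> a" "?V (Suc s + v) = F (Suc s + v) a"
      using max_from_attained by blast
    show ?thesis
    proof (cases "a = m")
      case False
      then obtain c where c: "a = Suc c" "m \<le> c"
        using a(1) by (metis le_neq_implies_less less_Suc_eq_le less_imp_Suc_add linorder_not_le le_add1)
      then have "?V (Suc s + v) \<le> ?V (Suc s) + \<kappa>"
        using a shift[of "Suc s" c] max_from_ge[of c "Suc s"] by simp
      then show ?thesis using lower[of s] by linarith
    next
      case True
      \<comment> \<open>Extra drivers gain no more at \<open>s\<close> than at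
        \<open>Suc s + v\<close>, so optimality of \<open>m\<close> passes down.\<close>
      have "F s a' \<le> F s m" if "m \<le> a'" for a'
        using increasing_differences_le[of m a' s "Suc s + v"] max_from_ge[of a' "Suc s + v"]
          a True that by simp
      then have "?V s = F s m" by (intro max_from_eqI) auto
      moreover have "F (s + v) m \<le> ?V (s + v)" "F (Suc s) m \<le> ?V (Suc s)"
        by (auto intro: max_from_ge)
      \<comment> \<open>Increasing differences between \<open>m\<close> and \<open>Suc m\<close> at
        \<open>s + v\<close>, where \<open>shift\<close> trades the extra driver for
        \<open>v\<close> orders of backlog.\<close>
      moreover have "F (Suc s + v) m - F (Suc s) m \<le> F (s + v) m - F s m"
        using increasing_differences[of "s + v" m] shift[of s m] shift[of "Suc s" m] by simp
      ultimately show ?thesis using a(2) unfolding True by linarith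
    qed
  qed
  ultimately show ?thesis
    unfolding step_concave_def antimono_iff_le_Suc by simp
qed

lemma least_argmax_from_props:
  shows least_argmax_from_ge: "m \<le> least_argmax_from m (F s)"
    and le_least_argmax_from: "m \<le> a \<Longrightarrow> F s a \<le> F s (least_argmax_from m (F s))"
proof -
  have "\<exists>a. is_arg_max (F s) (\<lambda>a. a \<in> {m..}) a"
    using attains_max[of s] by (auto simp: is_arg_max_def not_less)
  then have "is_arg_max (F s) (\<lambda>a. a \<in> {m..}) (least_argmax_from m (F s))"
    unfolding least_argmax_from_def by (rule LeastI_ex)
  then show "m \<le> least_argmax_from m (F s)"
    and "m \<le> a \<Longrightarrow> F s a \<le> F s (least_argmax_from m (F s))"
    by (auto simp: is_arg_max_def not_less)
qed

text \<open>The form in which minimality is used: an action that ties with the smallest maximizer is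
  itself a maximizer.\<close>

lemma least_argmax_from_le:
  assumes "m \<le> a" "F s (least_argmax_from m (F s)) \<le> F s a"
  shows "least_argmax_from m (F s) \<le> a"
proof -
  have "F s a' \<le> F s a" if "m \<le> a'" for a'
    using le_least_argmax_from[OF that, of s] assms(2) by linarith
  then have "is_arg_max (F s) (\<lambda>a. a \<in> {m..}) a"
    using assms(1) by (auto simp: is_arg_max_def not_less)
  then show ?thesis
    unfolding least_argmax_from_def by (rule Least_le)
qed

text \<open>If the count dropped, minimality would make the larger count strictly better at
  \<open>s\<close>, and increasing differences would keep it strictly better at
  \<open>Suc s\<close>.\<close>

lemma least_argmax_from_mono: "mono (\<lambda>s. least_argmax_from m (F s))"
  unfolding mono_iff_le_Suc
proof
  fix s
  let ?a = "least_argmax_from m (F s)" and ?a' = "least_argmax_from m (F (Suc s))"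
  show "?a \<le> ?a'"
  proof (rule ccontr)
    assume less: "\<not> ?a \<le> ?a'"
    then have "F s ?a' < F s ?a"
      using least_argmax_from_le least_argmax_from_ge by (meson not_less)
    moreover have "F (Suc s) ?a \<le> F (Suc s) ?a'"
      by (intro le_least_argmax_from least_argmax_from_ge)
    ultimately show False
      using increasing_differences_le[of ?a' ?a s "Suc s"] less by linarith
  qed
qed

text \<open>Otherwise, removing one driver and \<open>v\<close> orders leaves a feasible action at
  \<open>s\<close>, no better than \<open>?a\<close>. Adding both back shows that
  \<open>Suc ?a\<close> already attains the maximum at \<open>s + v\<close>.\<close>

lemma least_argmax_from_shift:
  "least_argmax_from m (F (s + v)) \<le> Suc (least_argmax_from m (F s))"
proof (rule ccontr)
  let ?a = "least_argmax_from m (F s)" and ?a' = "least_argmax_from m (F (s + v))"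
  assume less: "\<not> ?a' \<le> Suc ?a"
  then obtain c where c: "?a' = Suc c" "?a \<le> c"
    by (cases ?a') auto
  have "F (s + v) ?a' \<le> F (s + v) (Suc ?a)"
    using c le_least_argmax_from[of c s] least_argmax_from_ge[of s] by (simp add: shift)
  then have "?a' \<le> Suc ?a"
    using least_argmax_from_ge[of s] by (intro least_argmax_from_le) auto
  with less show False by blast
qed

end

text \<open>Only served orders and carried-over backlog enter \<open>g\<close>, since costs linear
  in \<open>s\<close> or \<open>a\<close> cancel. If \<open>a\<close> drivers leave nothing at
  \<open>Suc y\<close>, both sides vanish; if at least \<open>v\<close> orders remain at
  \<open>y\<close>, step concavity applies; if fewer remain, the extra driver clears them all, and
  \<open>q\<close> and the monotonicity of \<open>U\<close> decide.\<close>

lemma increasing_differences_served: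
  fixes v :: nat and U :: "nat \<Rightarrow> real" and q :: real
  assumes U: "step_concave v U" and q: "0 \<le> q"
  defines "g \<equiv> \<lambda>y a. q * real (min y (v * a)) + U (y - v * a)"
  shows "g y (Suc a) - g y a \<le> g (Suc y) (Suc a) - g (Suc y) a"
proof -
  have dec: "U (Suc z) \<le> U z" and conc: "U (Suc z + v) - U (Suc z) \<le> U (z + v) - U z" for z
    using U unfolding step_concave_def antimono_iff_le_Suc by auto
  show ?thesis
  proof (cases "v * a \<le> y")
    case False
    then show ?thesis by (simp add: g_def min_def)
  next
    case True
    then obtain z where y: "y = v * a + z" using le_Suc_ex by blast
    show ?thesis
    proof (cases "v \<le> z")
      case True
      then obtain z' where "z = z' + v" by (metis le_add_diff_inverse2)
      then show ?thesis
        using conc[of z'] by (auto simp: g_def y min_def algebra_simps)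
    next
      case False
      then show ?thesis
        using dec[of z] q by (auto simp: g_def y min_def algebra_simps Suc_diff_le)
    qed
  qed
qed

section \<open>Predictive law of the demand, belief update and the one-period lookahead\<close>

definition demand_weight ::
  "('d, 'h) params \<Rightarrow> ('k::finite, 'd, 'h) store \<Rightarrow> nat \<Rightarrow> real ^ 'k \<Rightarrow> nat \<Rightarrow> real" where
  "demand_weight M S t b x = (\<Sum>k\<in>UNIV. b $ k * emission_prob M S t k x)"

lemma demand_weight_nonneg:
  assumes "b \<in> beliefs"
  shows "0 \<le> demand_weight M S t b x"
  using assms by (auto simp: demand_weight_def beliefs_def emission_prob_def intro!: sum_nonneg)

text \<open>Total mass one lets the constant of \<open>shift\<close> pass through the expectation
  unchanged.\<close>

lemma sum_demand_weight:
  assumes "valid_store M S" "t \<in> {1..horizon M}" "b \<in> beliefs"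
  shows "(\<Sum>x = 0..x_max M. demand_weight M S t b x) = 1"
proof -
  have "(\<Sum>x = 0..x_max M. emission_prob M S t k x) = 1" for k
    using assms unfolding emission_prob_def valid_store_def
    by (intro sum_pmf_eq_1) auto
  then have "(\<Sum>k\<in>UNIV. b $ k * (\<Sum>x = 0..x_max M. emission_prob M S t k x)) = 1"
    using assms by (simp add: beliefs_def)
  then show ?thesis
    unfolding demand_weight_def by (subst sum.swap) (simp add: sum_distrib_left)
qed

text \<open>Reward and next belief do not depend on the regime, so the regimes can be averaged out
  first.\<close>

lemma lookahead_eq_expectation:
  "lookahead M S lam t W s b a =
     (\<Sum>x = 0..x_max M. demand_weight M S t b x *
        (reward_at M lam x s a + W (next_backlog M x s a) (next_belief M S t b x)))"
  unfolding lookahead_def demand_weight_def sum_distrib_left sum_distrib_right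
  by (subst sum.swap) (simp add: mult_ac)

text \<open>The Bayes posterior \<open>p\<close> is a probability vector, and a transposed
  row-stochastic matrix preserves such vectors. This is needed because continuation values are
  controlled only on \<open>beliefs\<close>.\<close>

lemma next_belief_in_beliefs:
  assumes S: "valid_store M S" and t: "t \<in> {1..horizon M}" and b: "b \<in> beliefs"
    and x: "x \<in> {0..x_max M}"
  shows "next_belief M S t b x \<in> beliefs"
proof (cases "demand_weight M S t b x = 0")
  case True
  then show ?thesis
    using assms by (simp add: next_belief_def demand_weight_def valid_store_def)
next
  case False
  define p where "p = (\<lambda>j. b $ j * emission_prob M S t j x / demand_weight M S t b x)"
  have nb: "next_belief M S t b x = transpose (trans_mat S) *v (\<chi> j. p j)"
    using False by (simp add: next_belief_def demand_weight_def p_def Let_def)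
  have p: "0 \<le> p j" for j
    using b demand_weight_nonneg[OF b, of M S t x]
    by (auto simp: p_def beliefs_def emission_prob_def)
  have "(\<Sum>j\<in>UNIV. p j) = 1"
    using False by (simp add: p_def demand_weight_def flip: sum_divide_distrib)
  moreover have T: "0 \<le> trans_mat S $ i $ j" "(\<Sum>j\<in>UNIV. trans_mat S $ i $ j) = 1" for i j
    using S by (auto simp: valid_store_def beliefs_def row_def)
  ultimately have "(\<Sum>j\<in>UNIV. \<Sum>i\<in>UNIV. trans_mat S $ i $ j * p i) = 1"
    by (subst sum.swap) (simp flip: sum_distrib_right)
  then show ?thesis
    using p T by (auto simp: nb beliefs_def matrix_vector_mult_def transpose_def intro!: sum_nonneg)
qed

text \<open>The next belief depends on the demand \<open>x\<close> but on neither \<open>s\<close>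
  nor \<open>a\<close>, so a single continuation function \<open>U x\<close> belongs to each
  \<open>x\<close>. The properties are checked for each \<open>x\<close> and averaged with
  nonnegative weights.\<close>

lemma driver_problem_lookahead:
  assumes M: "valid_params M" and S: "valid_store M S" and lam: "0 \<le> lam"
    and t: "t \<in> {1..horizon M}" and b: "b \<in> beliefs"
    and W: "\<And>b. b \<in> beliefs \<Longrightarrow> step_concave (capacity M) (\<lambda>s. W s b)"
  shows "driver_problem (\<lambda>s. lookahead M S lam t W s b) (a_min M) (capacity M)
           ((price M - c_p M - c_b M) * real (capacity M) - (c_a M + lam))"
proof -
  define w where "w = demand_weight M S t b"
  define U where "U x s = W s (next_belief M S t b x)" for x s
  define v where "v = capacity M"
  define q where "q = price M - c_p M"
  define G where "G x s a = reward_at M lam x s a + U x (x + s - v * a)" for x s a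
  have G: "G x s a = q * real (min (x + s) (v * a)) + U x (x + s - v * a)
             - (c_a M + lam) * real a - c_b M * real s" for x s a
    by (simp add: G_def reward_at_def reward_def q_def v_def algebra_simps)
  have look: "lookahead M S lam t W s b a = (\<Sum>x = 0..x_max M. w x * G x s a)" for s a
    by (simp add: lookahead_eq_expectation w_def G_def U_def next_backlog_def v_def)
  have w: "0 \<le> w x" for x
    unfolding w_def using b by (rule demand_weight_nonneg)
  have w1: "(\<Sum>x = 0..x_max M. w x) = 1"
    unfolding w_def using S t b by (rule sum_demand_weight)
  have U: "step_concave v (U x)" if "x \<in> {0..x_max M}" for x
    unfolding U_def v_def using W next_belief_in_beliefs[OF S t b that] by blast
  have q: "0 < q" "q < c_b M" and c: "0 < c_a M + lam"
    using M lam by (auto simp: valid_params_def q_def)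
  show ?thesis
  proof
    fix s a
    have "G x s (Suc a) - G x s a \<le> G x (Suc s) (Suc a) - G x (Suc s) a"
      if "x \<in> {0..x_max M}" for x
      using increasing_differences_served[OF U[OF that], of q "x + s" a] q
      by (simp add: G algebra_simps)
    then show "lookahead M S lam t W s b (Suc a) - lookahead M S lam t W s b a
        \<le> lookahead M S lam t W (Suc s) b (Suc a) - lookahead M S lam t W (Suc s) b a"
      unfolding look sum_subtractf[symmetric] right_diff_distrib[symmetric]
      by (intro sum_mono mult_left_mono w)
  next
    fix s a
    \<comment> \<open>The \<open>v\<close> added orders earn \<open>q\<close> each and incur
      \<open>c_b\<close> each, the added driver costs \<open>c_a + lam\<close>, and the leftover
      backlog is unchanged.\<close>
    define \<kappa> where "\<kappa> = (q - c_b M) * real v - (c_a M + lam)"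
    have "G x (s + v) (Suc a) = G x s a + \<kappa>" for x
      by (simp add: G \<kappa>_def algebra_simps min_def)
    then have "lookahead M S lam t W (s + v) b (Suc a) = lookahead M S lam t W s b a + \<kappa>"
      using w1 by (simp add: look distrib_left sum.distrib flip: sum_distrib_right)
    then show "lookahead M S lam t W (s + capacity M) b (Suc a) = lookahead M S lam t W s b a
        + ((price M - c_p M - c_b M) * real (capacity M) - (c_a M + lam))"
      by (simp add: \<kappa>_def q_def v_def)
  next
    fix s a
    \<comment> \<open>One more order earns at most \<open>q\<close>, less than its backlog cost
      \<open>c_b\<close>, and cannot raise the continuation value.\<close>
    have "G x (Suc s) a \<le> G x s a" if "x \<in> {0..x_max M}" for x
    proof -
      have "U x (x + Suc s - v * a) \<le> U x (x + s - v * a)"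
        using U[OF that] by (auto simp: step_concave_def intro: antimonoD)
      moreover have "q * real (min (x + Suc s) (v * a)) \<le> q * (real (min (x + s) (v * a)) + 1)"
        using q by (intro mult_left_mono) auto
      ultimately show ?thesis
        using q unfolding G by (simp add: algebra_simps)
    qed
    then show "lookahead M S lam t W (Suc s) b a \<le> lookahead M S lam t W s b a"
      unfolding look by (intro sum_mono mult_left_mono w)
  next
    fix s
    have v: "1 \<le> v" using M by (simp add: valid_params_def v_def)
    \<comment> \<open>From this action on every possible demand is fully served, so another driver
      only adds cost.\<close>
    have "lookahead M S lam t W s b (Suc a) \<le> lookahead M S lam t W s b a"
      if a: "x_max M + s \<le> a" for a
    proof -
      have "G x s (Suc a) \<le> G x s a" if "x \<in> {0..x_max M}" for x
      proof -
        have "x + s \<le> a" using a that by simp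
        also have "a \<le> v * a" using v by simp
        finally have "x + s \<le> v * a" .
        then show ?thesis using c by (simp add: G min_def algebra_simps)
      qed
      then show ?thesis
        unfolding look by (intro sum_mono mult_left_mono w)
    qed
    then show "\<exists>a\<ge>a_min M. \<forall>a'\<ge>a_min M.
        lookahead M S lam t W s b a' \<le> lookahead M S lam t W s b a"
      by (rule eventually_nonincreasing_attains_max)
  qed
qed

section \<open>Backward induction over periods, optimal driver counts and priority indices\<close>

lemma V_eq_max_from:
  assumes "t \<le> horizon M"
  shows "V M S lam t s b = max_from (a_min M) (lookahead M S lam t (V M S lam (Suc t)) s b)"
  using assms by (subst V.simps) (simp add: max_from_def)

text \<open>The terminal value is linear with negative slope, so its \<open>v\<close>-step
  increments are constant; each earlier period then inherits the property from its
  successor.\<close>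

lemma step_concave_V:
  assumes M: "valid_params M" and S: "valid_store M S" and lam: "0 \<le> lam"
    and "1 \<le> t" "t \<le> Suc (horizon M)" and "b \<in> beliefs"
  shows "step_concave (capacity M) (\<lambda>s. V M S lam t s b)"
  using assms(5,4,6)
proof (induction t arbitrary: b rule: inc_induct)
  case base
  have "0 < c_lost M" using M by (simp add: valid_params_def)
  then show ?case
    by (simp add: V.simps step_concave_def antimono_iff_le_Suc algebra_simps)
next
  case (step t)
  interpret driver_problem "\<lambda>s. lookahead M S lam t (V M S lam (Suc t)) s b" "a_min M" "capacity M"
    "(price M - c_p M - c_b M) * real (capacity M) - (c_a M + lam)"
    using step by (intro driver_problem_lookahead M S lam) auto
  show ?case
    using step_concave_max_from step.hyps by (simp add: V_eq_max_from)
qed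

lemma
  assumes "valid_params M" "valid_store M S" "0 \<le> lam" "t \<in> {1..horizon M}" "b \<in> beliefs"
  shows opt_drivers_mono: "mono (\<lambda>s. opt_drivers M S lam t s b)"
    and opt_drivers_shift:
      "opt_drivers M S lam t (s + capacity M) b \<le> Suc (opt_drivers M S lam t s b)"
proof -
  have opt: "opt_drivers M S lam t s b =
      least_argmax_from (a_min M) (lookahead M S lam t (V M S lam (Suc t)) s b)" for s
    by (simp add: opt_drivers_def least_argmax_from_def Q_def [abs_def])
  interpret driver_problem "\<lambda>s. lookahead M S lam t (V M S lam (Suc t)) s b" "a_min M" "capacity M"
    "(price M - c_p M - c_b M) * real (capacity M) - (c_a M + lam)"
    using assms by (intro driver_problem_lookahead step_concave_V) auto
  show "mono (\<lambda>s. opt_drivers M S lam t s b)"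
    and "opt_drivers M S lam t (s + capacity M) b \<le> Suc (opt_drivers M S lam t s b)"
    unfolding opt by (rule least_argmax_from_mono least_argmax_from_shift)+
qed

theorem corollary1:
  fixes M :: "('d, 'h) params"
    and S :: "nat \<Rightarrow> ('k::finite, 'd, 'h) store"
    and L :: nat
  assumes "valid_params M"
    and "\<And>l. l \<in> {1..L} \<Longrightarrow> valid_store M (S l)"
  shows "\<forall>l\<in>{1..L}. \<forall>t\<in>{1..horizon M}. \<forall>b\<in>beliefs. \<forall>j\<ge>1.
           mono (\<lambda>s. priority_index M (S l) t j s b) \<and>
           (\<forall>s. priority_index M (S l) t (j + 1) (s + capacity M) b
                  \<le> priority_index M (S l) t j s b)"
proof (intro ballI allI impI conjI)
  fix l t j and b :: "real ^ 'k"
  assume l: "l \<in> {1..L}" and t: "t \<in> {1..horizon M}" and b: "b \<in> beliefs"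
  note opt = assms(1) assms(2)[OF l] _ t b
  show "mono (\<lambda>s. priority_index M (S l) t j s b)"
  proof (rule monoI)
    fix s s' :: nat
    assume "s \<le> s'"
    then have "opt_drivers M (S l) lam t s b \<le> opt_drivers M (S l) lam t s' b" if "0 \<le> lam" for lam
      using opt_drivers_mono[OF opt] that by (auto dest: monoD)
    \<comment> \<open>A larger backlog leaves fewer prices in the set, and the infimum in
      \<open>ereal\<close> grows as the set shrinks, also when it becomes empty.\<close>
    then have "{lam. 0 \<le> lam \<and> opt_drivers M (S l) lam t s' b < j}
        \<subseteq> {lam. 0 \<le> lam \<and> opt_drivers M (S l) lam t s b < j}"
      using le_less_trans by blast
    then show "priority_index M (S l) t j s b \<le> priority_index M (S l) t j s' b"
      unfolding priority_index_def by (intro Inf_superset_mono image_mono)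
  qed
  fix s
  have "opt_drivers M (S l) lam t (s + capacity M) b < j + 1"
    if "0 \<le> lam" "opt_drivers M (S l) lam t s b < j" for lam
    using opt_drivers_shift[OF opt, of lam s] that by simp
  \<comment> \<open>The count rises by at most one driver, which the rank \<open>j + 1\<close>
    absorbs at every price.\<close>
  then have "{lam. 0 \<le> lam \<and> opt_drivers M (S l) lam t s b < j}
      \<subseteq> {lam. 0 \<le> lam \<and> opt_drivers M (S l) lam t (s + capacity M) b < j + 1}"
    by blast
  then show "priority_index M (S l) t (j + 1) (s + capacity M) b \<le> priority_index M (S l) t j s b"
    unfolding priority_index_def by (intro Inf_superset_mono image_mono)
qed

end
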